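(* Let $(L,<)$ be a finite lattice with complementary order relation $\lambda$, and let $\mathrm{Canon}\colon L\to\mathbb{R}^2$ be the associated canonical map, $\mathrm{Canon}(p)=(\mathrm{Imb}(p,\lambda),\mathrm{Imb}(p,<))$. Let $\bar L=\mathrm{Canon}(L)$ with slanted order. Then: (1) $\bar L$ is a planar lattice diagram in planar canonical form. (2) $\mathrm{Canon}$ is an isomorphism of $(L,<,\lambda)$ with $(\bar L,<,<_{\mathrm{lr}})$ as oriented planar lattices.
   Context: "Order" means strict partial order (irreflexive and transitive); $\prec$ is the covering relation of the lattice order. A complementary order relation of a finite ordered set $(P,<)$ is a strict partial order $\lambda$ on $P$ such that any two distinct elements of $P$ are comparable by exactly one of $<$ and $\lambda$. Points of $\mathbb{R}^2$ are written $u=(u_x,u_y)$, and $\overline{pq}$ is the straight line segment from $p$ to $q$. A diagram is a finite ordered set $H$ whose elements are distinct points of $\mathbb{R}^2$ such that for each covering $p\prec q$ in $H$ we have $p_y<q_y$ and $\overline{pq}\cap H=\{p,q\}$. A diagram is planar if any two distinct covering segments are disjoint or intersect only at their endpoints. A planar lattice diagram is a planar diagram that is a lattice as an ordered set; a finite lattice is planar if it is isomorphic to some planar lattice diagram. For a finite strictly ordered set $(P,\rho)$ and $p\in P$, the imbalance is $\mathrm{Imb}(p,\rho)=|\{q\in P: q\mathrel{\rho}p\}|-|\{q\in P: p\mathrel{\rho}q\}|$. The slanted order on $\mathbb{R}^2$: $p<q$ if $p\ne q$ and the vector $q-p$ makes an angle of at most $45^\circ$ (in absolute value) with the positive $y$-axis.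 Its complementary order $<_{\mathrm{lr}}$: $p<_{\mathrm{lr}}q$ if $p\neq q$ and $q-p$ makes an angle of less than $45^\circ$ (in absolute value) with the positive $x$-axis. Subsets of $\mathbb{R}^2$ "with slanted order" carry the restrictions of $<$ and $<_{\mathrm{lr}}$. A planar lattice diagram $M$ is in planar canonical form if its order is the slanted order and $p=(\mathrm{Imb}(p,<_{\mathrm{lr}}),\mathrm{Imb}(p,<))$ for each $p\in M$ (imbalances computed in $M$). An oriented planar lattice is a triple $(L,<,\lambda)$ where $(L,<)$ is a planar lattice and $\lambda$ is a specified order relation complementary to $<$. An isomorphism of oriented planar lattices is a bijection preserving and reflecting both relations. *)

theory Defs
  imports "HOL-Analysis.Analysis" "HOL-Algebra.Lattice"
begin

text \<open>An ordered set is a carrier \<open>P\<close> with a predicate \<open>r\<close>; only the values of \<open>r\<close>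
  on \<open>P\<close> matter, so relations given on a whole type are restricted to \<open>P\<close> implicitly.\<close>

definition strict_order_on :: "'a set \<Rightarrow> ('a \<Rightarrow> 'a \<Rightarrow> bool) \<Rightarrow> bool" where
  "strict_order_on P r \<longleftrightarrow> irreflp_on P r \<and> transp_on P r"

definition weak_gorder :: "'a set \<Rightarrow> ('a \<Rightarrow> 'a \<Rightarrow> bool) \<Rightarrow> 'a gorder" where
  "weak_gorder P r = \<lparr>carrier = P, eq = (=), le = (\<lambda>x y. x = y \<or> r x y)\<rparr>"

text \<open>As in \<open>HOL-Algebra\<close>, the empty carrier is not excluded.\<close>

definition lattice_order_on :: "'a set \<Rightarrow> ('a \<Rightarrow> 'a \<Rightarrow> bool) \<Rightarrow> bool" where
  "lattice_order_on P r \<longleftrightarrow> strict_order_on P r \<and> Lattice.lattice (weak_gorder P r)"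

definition complementary_order_on ::
    "'a set \<Rightarrow> ('a \<Rightarrow> 'a \<Rightarrow> bool) \<Rightarrow> ('a \<Rightarrow> 'a \<Rightarrow> bool) \<Rightarrow> bool" where
  "complementary_order_on P r l \<longleftrightarrow> strict_order_on P l \<and>
     (\<forall>p\<in>P. \<forall>q\<in>P. p \<noteq> q \<longrightarrow> (r p q \<or> r q p) \<noteq> (l p q \<or> l q p))"

definition covers_on :: "'a set \<Rightarrow> ('a \<Rightarrow> 'a \<Rightarrow> bool) \<Rightarrow> 'a \<Rightarrow> 'a \<Rightarrow> bool" where
  "covers_on P r p q \<longleftrightarrow> p \<in> P \<and> q \<in> P \<and> r p q \<and> \<not> (\<exists>z\<in>P. r p z \<and> r z q)"

definition order_iso_on ::
    "'a set \<Rightarrow> ('a \<Rightarrow> 'a \<Rightarrow> bool) \<Rightarrow> 'b set \<Rightarrow> ('b \<Rightarrow> 'b \<Rightarrow> bool) \<Rightarrow> ('a \<Rightarrow> 'b) \<Rightarrow> bool" where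
  "order_iso_on P r Q s f \<longleftrightarrow> bij_betw f P Q \<and> (\<forall>x\<in>P. \<forall>y\<in>P. r x y \<longleftrightarrow> s (f x) (f y))"

type_synonym point = "real \<times> real"

definition diagram :: "point set \<Rightarrow> (point \<Rightarrow> point \<Rightarrow> bool) \<Rightarrow> bool" where
  "diagram H r \<longleftrightarrow> finite H \<and> strict_order_on H r \<and>
     (\<forall>p q. covers_on H r p q \<longrightarrow> snd p < snd q \<and> closed_segment p q \<inter> H = {p, q})"

definition planar_diagram :: "point set \<Rightarrow> (point \<Rightarrow> point \<Rightarrow> bool) \<Rightarrow> bool" where
  "planar_diagram H r \<longleftrightarrow> diagram H r \<and>
     (\<forall>p q p' q'. covers_on H r p q \<and> covers_on H r p' q' \<and>
        closed_segment p q \<noteq> closed_segment p' q' \<longrightarrow>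
        closed_segment p q \<inter> closed_segment p' q' \<subseteq> {p, q} \<inter> {p', q'})"

definition planar_lattice_diagram :: "point set \<Rightarrow> (point \<Rightarrow> point \<Rightarrow> bool) \<Rightarrow> bool" where
  "planar_lattice_diagram M r \<longleftrightarrow> planar_diagram M r \<and> lattice_order_on M r"

definition planar_lattice :: "'a set \<Rightarrow> ('a \<Rightarrow> 'a \<Rightarrow> bool) \<Rightarrow> bool" where
  "planar_lattice L r \<longleftrightarrow> finite L \<and> lattice_order_on L r \<and>
     (\<exists>M s f. planar_lattice_diagram M s \<and> order_iso_on L r M s f)"

definition imbalance :: "'a set \<Rightarrow> ('a \<Rightarrow> 'a \<Rightarrow> bool) \<Rightarrow> 'a \<Rightarrow> int" where
  "imbalance P r p = int (card {q\<in>P. r q p}) - int (card {q\<in>P. r p q})"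

text \<open>The unsigned angle in \<open>[0, pi]\<close> between two nonzero vectors.\<close>

definition vec_angle :: "point \<Rightarrow> point \<Rightarrow> real" where
  "vec_angle u v = arccos ((u \<bullet> v) / (norm u * norm v))"

definition slanted :: "point \<Rightarrow> point \<Rightarrow> bool" where
  "slanted p q \<longleftrightarrow> p \<noteq> q \<and> vec_angle (q - p) (0, 1) \<le> pi / 4"

definition slanted_lr :: "point \<Rightarrow> point \<Rightarrow> bool" where
  "slanted_lr p q \<longleftrightarrow> p \<noteq> q \<and> vec_angle (q - p) (1, 0) < pi / 4"

definition planar_canonical_form :: "point set \<Rightarrow> (point \<Rightarrow> point \<Rightarrow> bool) \<Rightarrow> bool" where
  "planar_canonical_form M r \<longleftrightarrow> planar_lattice_diagram M r \<and>
     (\<forall>p\<in>M. \<forall>q\<in>M. r p q \<longleftrightarrow> slanted p q) \<and>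
     (\<forall>p\<in>M. p = (real_of_int (imbalance M slanted_lr p), real_of_int (imbalance M r p)))"

definition oriented_planar_lattice ::
    "'a set \<Rightarrow> ('a \<Rightarrow> 'a \<Rightarrow> bool) \<Rightarrow> ('a \<Rightarrow> 'a \<Rightarrow> bool) \<Rightarrow> bool" where
  "oriented_planar_lattice L r l \<longleftrightarrow> planar_lattice L r \<and> complementary_order_on L r l"

definition oriented_planar_lattice_iso ::
    "'a set \<Rightarrow> ('a \<Rightarrow> 'a \<Rightarrow> bool) \<Rightarrow> ('a \<Rightarrow> 'a \<Rightarrow> bool) \<Rightarrow>
     'b set \<Rightarrow> ('b \<Rightarrow> 'b \<Rightarrow> bool) \<Rightarrow> ('b \<Rightarrow> 'b \<Rightarrow> bool) \<Rightarrow> ('a \<Rightarrow> 'b) \<Rightarrow> bool" where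
  "oriented_planar_lattice_iso L r l M s m f \<longleftrightarrow>
     oriented_planar_lattice L r l \<and> oriented_planar_lattice M s m \<and>
     order_iso_on L r M s f \<and> order_iso_on L l M m f"

definition canon :: "'a set \<Rightarrow> ('a \<Rightarrow> 'a \<Rightarrow> bool) \<Rightarrow> ('a \<Rightarrow> 'a \<Rightarrow> bool) \<Rightarrow> 'a \<Rightarrow> point" where
  "canon L r l p = (real_of_int (imbalance L l p), real_of_int (imbalance L r p))"

end

theory Submission
  imports Defs
begin

text \<open>Both unions of \<open><\<close> with \<open>\<lambda>\<close> and with its converse are linear orders, and the
  imbalances of these unions are the sum and the difference of the coordinates of
  \<open>Canon\<close>. Hence \<open>Canon\<close> carries \<open><\<close> to the slanted order and \<open>\<lambda>\<close> to its left-to-right companion.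
  Planarity holds for every finite set on which the slanted order is a lattice: if two covering
  segments \<open>pq\<close> and \<open>p'q'\<close> meet in a point outside the set, the join of \<open>p\<close> and \<open>p'\<close>
  lies between \<open>p\<close> and \<open>q\<close> and between \<open>p'\<close> and \<open>q'\<close>, which forces \<open>p = p'\<close> or
  \<open>q = q'\<close>; two such segments with a common endpoint and another common point are
  collinear, hence equal.\<close>

section \<open>Strict orders, lattices and their transport along isomorphisms\<close>

lemma strict_order_onD:
  assumes "strict_order_on P r"
  shows strict_order_on_irrefl: "x \<in> P \<Longrightarrow> \<not> r x x"
    and strict_order_on_trans: "x \<in> P \<Longrightarrow> y \<in> P \<Longrightarrow> z \<in> P \<Longrightarrow> r x y \<Longrightarrow> r y z \<Longrightarrow> r x z"
  using assms by (auto simp: strict_order_on_def irreflp_on_def elim: transp_onD)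

text \<open>Replaces the record-based axioms by bounded quantifiers over \<open>P\<close>, the form
  in which lattices are transported and joins are taken. Strictness of \<open>r\<close> yields the
  partial order axioms of \<open>weak_gorder P r\<close>, so only the existence of bounds
  remains.\<close>

lemma lattice_order_on_iff:
  "lattice_order_on P r \<longleftrightarrow> strict_order_on P r \<and>
     (\<forall>x\<in>P. \<forall>y\<in>P. \<exists>s\<in>P. r\<^sup>=\<^sup>= x s \<and> r\<^sup>=\<^sup>= y s \<and> (\<forall>z\<in>P. r\<^sup>=\<^sup>= x z \<and> r\<^sup>=\<^sup>= y z \<longrightarrow> r\<^sup>=\<^sup>= s z)) \<and>
     (\<forall>x\<in>P. \<forall>y\<in>P. \<exists>s\<in>P. r\<^sup>=\<^sup>= s x \<and> r\<^sup>=\<^sup>= s y \<and> (\<forall>z\<in>P. r\<^sup>=\<^sup>= z x \<and> r\<^sup>=\<^sup>= z y \<longrightarrow> r\<^sup>=\<^sup>= z s))"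
  (is "_ \<longleftrightarrow> _ \<and> ?sup \<and> ?inf")
proof (cases "strict_order_on P r")
  case True
  let ?G = "weak_gorder P r"
  have carrier: "carrier ?G = P" and le: "le ?G = r\<^sup>=\<^sup>=" and eq: "eq ?G = (=)"
    by (auto simp: weak_gorder_def fun_eq_iff)
  note irr = strict_order_on_irrefl[OF True] and tr = strict_order_on_trans[OF True]
  have po: "partial_order ?G"
  proof (unfold_locales, unfold carrier le eq)
    show "x = y" if "r\<^sup>=\<^sup>= x y" "r\<^sup>=\<^sup>= y x" "x \<in> P" "y \<in> P" for x y
      using that tr[of x y x] irr[of x] by auto
    show "r\<^sup>=\<^sup>= x z" if "r\<^sup>=\<^sup>= x y" "r\<^sup>=\<^sup>= y z" "x \<in> P" "y \<in> P" "z \<in> P" for x y z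
      using that tr[of x y z] by auto
  qed simp_all
  have sup: "(\<exists>s. least ?G s (Upper ?G {x, y})) \<longleftrightarrow>
      (\<exists>s\<in>P. r\<^sup>=\<^sup>= x s \<and> r\<^sup>=\<^sup>= y s \<and> (\<forall>z\<in>P. r\<^sup>=\<^sup>= x z \<and> r\<^sup>=\<^sup>= y z \<longrightarrow> r\<^sup>=\<^sup>= s z))"
    if "x \<in> P" "y \<in> P" for x y
  proof -
    have "Upper ?G {x, y} = {u\<in>P. r\<^sup>=\<^sup>= x u \<and> r\<^sup>=\<^sup>= y u}"
      unfolding Upper_def carrier le using that by blast
    then show ?thesis
      unfolding least_def carrier le by (simp add: subset_iff Ball_def Bex_def imp_conjL)
  qed
  have inf: "(\<exists>s. greatest ?G s (Lower ?G {x, y})) \<longleftrightarrow>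
      (\<exists>s\<in>P. r\<^sup>=\<^sup>= s x \<and> r\<^sup>=\<^sup>= s y \<and> (\<forall>z\<in>P. r\<^sup>=\<^sup>= z x \<and> r\<^sup>=\<^sup>= z y \<longrightarrow> r\<^sup>=\<^sup>= z s))"
    if "x \<in> P" "y \<in> P" for x y
  proof -
    have "Lower ?G {x, y} = {u\<in>P. r\<^sup>=\<^sup>= u x \<and> r\<^sup>=\<^sup>= u y}"
      unfolding Lower_def carrier le using that by blast
    then show ?thesis
      unfolding greatest_def carrier le by (simp add: subset_iff Ball_def Bex_def imp_conjL)
  qed
  have "Lattice.lattice ?G \<longleftrightarrow>
      (\<forall>x\<in>P. \<forall>y\<in>P. \<exists>s. least ?G s (Upper ?G {x, y})) \<and>
      (\<forall>x\<in>P. \<forall>y\<in>P. \<exists>s. greatest ?G s (Lower ?G {x, y}))"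
    unfolding Lattice.lattice_def upper_semilattice_def lower_semilattice_def
      upper_semilattice_axioms_def lower_semilattice_axioms_def carrier Ball_def
    using po by blast
  also have "\<dots> \<longleftrightarrow> ?sup \<and> ?inf"
    by (intro arg_cong2[where f = conj] ball_cong refl sup inf)
  finally show ?thesis
    using True by (simp only: lattice_order_on_def simp_thms)
qed (simp add: lattice_order_on_def)

lemma order_iso_on_strict_order:
  assumes iso: "order_iso_on P r Q s f" and r: "strict_order_on P r"
  shows "strict_order_on Q s"
proof -
  have Q: "Q = f ` P" using iso by (auto simp: order_iso_on_def bij_betw_def)
  have eq: "s (f x) (f y) \<longleftrightarrow> r x y" if "x \<in> P" "y \<in> P" for x y
    using iso that by (simp add: order_iso_on_def)
  have "irreflp_on Q s"
    unfolding Q using strict_order_on_irrefl[OF r] by (auto simp: irreflp_on_def eq)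
  moreover have "transp_on Q s"
  proof (rule transp_onI)
    fix u v w assume "u \<in> Q" "v \<in> Q" "w \<in> Q" and "s u v" "s v w"
    moreover from this obtain x y z where "u = f x" "v = f y" "w = f z" "x \<in> P" "y \<in> P" "z \<in> P"
      unfolding Q by blast
    ultimately show "s u w"
      using strict_order_on_trans[OF r, of x y z] by (simp add: eq)
  qed
  ultimately show ?thesis
    by (simp add: strict_order_on_def)
qed

lemma order_iso_on_lattice_order:
  assumes iso: "order_iso_on P r Q s f" and "lattice_order_on P r"
  shows "lattice_order_on Q s"
proof -
  define R where "R = r\<^sup>=\<^sup>="
  define S where "S = s\<^sup>=\<^sup>="
  have Q: "Q = f ` P" and inj: "inj_on f P"
    using iso by (auto simp: order_iso_on_def bij_betw_def)
  \<comment> \<open>Injectivity of \<open>f\<close> carries over the equality part of the reflexive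
    closures.\<close>
  have eq: "S (f x) (f y) \<longleftrightarrow> R x y" if "x \<in> P" "y \<in> P" for x y
    using iso inj that by (auto simp: R_def S_def order_iso_on_def inj_on_eq_iff)
  have ball: "(\<forall>x\<in>Q. A x) \<longleftrightarrow> (\<forall>x\<in>P. A (f x))" and bex: "(\<exists>x\<in>Q. A x) \<longleftrightarrow> (\<exists>x\<in>P. A (f x))" for A
    unfolding Q by blast+
  have lat: "\<forall>x\<in>P. \<forall>y\<in>P. \<exists>t\<in>P. R x t \<and> R y t \<and> (\<forall>z\<in>P. R x z \<and> R y z \<longrightarrow> R t z)"
    "\<forall>x\<in>P. \<forall>y\<in>P. \<exists>t\<in>P. R t x \<and> R t y \<and> (\<forall>z\<in>P. R z x \<and> R z y \<longrightarrow> R z t)"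
    and strict: "strict_order_on Q s"
    using assms(2) order_iso_on_strict_order[OF iso]
    unfolding lattice_order_on_iff R_def[symmetric] by simp_all
  have sup: "\<exists>t\<in>P. S (f x) (f t) \<and> S (f y) (f t) \<and>
      (\<forall>z\<in>P. S (f x) (f z) \<and> S (f y) (f z) \<longrightarrow> S (f t) (f z))" if xy: "x \<in> P" "y \<in> P" for x y
  proof -
    obtain t where "t \<in> P" "R x t" "R y t" "\<forall>z\<in>P. R x z \<and> R y z \<longrightarrow> R t z"
      using lat(1) xy by blast
    then show ?thesis
      using xy by (intro bexI[of _ t]) (auto simp: eq)
  qed
  have inf: "\<exists>t\<in>P. S (f t) (f x) \<and> S (f t) (f y) \<and>
      (\<forall>z\<in>P. S (f z) (f x) \<and> S (f z) (f y) \<longrightarrow> S (f z) (f t))" if xy: "x \<in> P" "y \<in> P" for x y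
  proof -
    obtain t where "t \<in> P" "R t x" "R t y" "\<forall>z\<in>P. R z x \<and> R z y \<longrightarrow> R z t"
      using lat(2) xy by blast
    then show ?thesis
      using xy by (intro bexI[of _ t]) (auto simp: eq)
  qed
  show ?thesis
    unfolding lattice_order_on_iff S_def[symmetric] ball bex
    by (intro conjI ballI strict sup inf)
qed

section \<open>Complementary orders and imbalances\<close>

lemma complementary_order_onD:
  assumes "complementary_order_on P r l" "p \<in> P" "q \<in> P" "p \<noteq> q"
  shows "(r p q \<or> r q p) \<noteq> (l p q \<or> l q p)"
  using assms unfolding complementary_order_on_def
  by (elim conjE) (drule (1) bspec, drule (1) bspec, drule (1) mp)

text \<open>Lets \<open>slanted_lr\<close> inherit complementarity to \<open>slanted\<close> on the
  canonical image from the given pair of orders on \<open>L\<close>.\<close>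

lemma order_iso_on_complementary_order:
  assumes "order_iso_on P r Q s f" "order_iso_on P l Q m f" "complementary_order_on P r l"
  shows "complementary_order_on Q s m"
  unfolding complementary_order_on_def
proof (intro conjI ballI impI)
  show "strict_order_on Q m"
    using assms(3) by (intro order_iso_on_strict_order[OF assms(2)]) (simp add: complementary_order_on_def)
  fix u v assume "u \<in> Q" "v \<in> Q" "u \<noteq> v"
  moreover have "Q = f ` P" using assms(1) by (auto simp: order_iso_on_def bij_betw_def)
  ultimately obtain x y where xy: "x \<in> P" "y \<in> P" "u = f x" "v = f y" "x \<noteq> y"
    by auto
  have "s (f a) (f b) \<longleftrightarrow> r a b" "m (f a) (f b) \<longleftrightarrow> l a b" if "a \<in> P" "b \<in> P" for a b
    using assms(1,2) that by (simp_all add: order_iso_on_def)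
  then show "(s u v \<or> s v u) \<noteq> (m u v \<or> m v u)"
    using complementary_order_onD[OF assms(3) xy(1,2,5)] xy by simp
qed

text \<open>Reduces imbalances in the canonical image to those in \<open>L\<close>, which are the
  coordinates by definition of \<open>canon\<close>.\<close>

lemma order_iso_on_imbalance:
  assumes "order_iso_on P r Q s f" "p \<in> P"
  shows "imbalance Q s (f p) = imbalance P r p"
proof -
  have Q: "Q = f ` P" and inj: "inj_on f P"
    using assms(1) by (auto simp: order_iso_on_def bij_betw_def)
  have iso: "r x y \<longleftrightarrow> s (f x) (f y)" if "x \<in> P" "y \<in> P" for x y
    using assms(1) that by (simp add: order_iso_on_def)
  have "{q\<in>Q. s q (f p)} = f ` {q\<in>P. r q p}" "{q\<in>Q. s (f p) q} = f ` {q\<in>P. r p q}"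
    using Q iso assms(2) by auto
  then show ?thesis
    by (simp add: imbalance_def card_image inj_on_subset[OF inj])
qed

text \<open>From \<open>p\<close> up to \<open>q\<close> the set of smaller elements gains at least
  \<open>p\<close>, while the set of larger elements can only shrink.\<close>

lemma imbalance_strict_mono:
  assumes "finite P" "strict_order_on P r" "p \<in> P" "q \<in> P" "r p q"
  shows "imbalance P r p < imbalance P r q"
proof -
  note tr = strict_order_on_trans[OF assms(2)]
  have irr: "\<not> r p p"
    using assms(2,3) by (rule strict_order_on_irrefl)
  have "{z\<in>P. r z p} \<subset> {z\<in>P. r z q}"
    using tr[OF _ assms(3,4) _ assms(5)] irr assms(3-5) by auto
  then have "card {z\<in>P. r z p} < card {z\<in>P. r z q}"
    using assms(1) by (simp add: psubset_card_mono)
  moreover have "{z\<in>P. r q z} \<subseteq> {z\<in>P. r p z}"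
    using tr[OF assms(3,4) _ assms(5)] by auto
  then have "card {z\<in>P. r q z} \<le> card {z\<in>P. r p z}"
    using assms(1) by (simp add: card_mono)
  ultimately show ?thesis
    by (simp add: imbalance_def)
qed

lemma imbalance_conversep: "imbalance P r\<inverse>\<inverse> p = - imbalance P r p"
  by (simp add: imbalance_def)

text \<open>The elements below \<open>p\<close> in the union split into two disjoint sets, one for
  each relation, and so do those above; the counts add up.\<close>

lemma imbalance_disjoint_sup:
  assumes "finite P" "\<And>q. q \<in> P \<Longrightarrow> \<not> (r q p \<and> l q p)" "\<And>q. q \<in> P \<Longrightarrow> \<not> (r p q \<and> l p q)"
  shows "imbalance P (sup r l) p = imbalance P r p + imbalance P l p"
proof -
  have card: "card {q\<in>P. A q \<or> B q} = card {q\<in>P. A q} + card {q\<in>P. B q}"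
    if "\<And>q. q \<in> P \<Longrightarrow> \<not> (A q \<and> B q)" for A B
    using assms(1) that
    by (subst card_Un_disjoint[symmetric]) (auto intro!: arg_cong[where f = card])
  show ?thesis
    using card[of "\<lambda>q. r q p" "\<lambda>q. l q p"] card[of "r p" "l p"] assms(2,3)
    by (simp add: imbalance_def)
qed

text \<open>Allows the estimate for \<open>less\<close> to be reused for \<open>lam\<close> with the
  two coordinates exchanged.\<close>

lemma complementary_order_on_commute:
  assumes "strict_order_on P r" "complementary_order_on P r l"
  shows "complementary_order_on P l r"
  unfolding complementary_order_on_def
proof (intro conjI ballI impI assms(1))
  fix p q assume "p \<in> P" "q \<in> P" "p \<noteq> q"
  then have "(r p q \<or> r q p) \<noteq> (l p q \<or> l q p)"
    by (rule complementary_order_onD[OF assms(2)])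
  then show "(l p q \<or> l q p) \<noteq> (r p q \<or> r q p)" by (rule not_sym)
qed

lemma complementary_order_on_conversep:
  assumes "complementary_order_on P r l"
  shows "complementary_order_on P r l\<inverse>\<inverse>"
  unfolding complementary_order_on_def
proof (intro conjI ballI impI)
  show "strict_order_on P l\<inverse>\<inverse>"
    using assms by (simp add: complementary_order_on_def strict_order_on_def irreflp_on_def)
  fix p q assume "p \<in> P" "q \<in> P" "p \<noteq> q"
  then have "(r p q \<or> r q p) \<noteq> (l p q \<or> l q p)"
    by (rule complementary_order_onD[OF assms])
  then show "(r p q \<or> r q p) \<noteq> (l\<inverse>\<inverse> p q \<or> l\<inverse>\<inverse> q p)" by auto
qed

text \<open>The union is a tournament, and it has no 3-cycle because two consecutive edges of such a
  cycle would lie in the same order.\<close>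

lemma complementary_order_on_sup:
  assumes "strict_order_on P r" "complementary_order_on P r l"
  shows "strict_order_on P (sup r l)"
proof -
  have l: "strict_order_on P l"
    using assms(2) by (simp add: complementary_order_on_def)
  note irr = strict_order_on_irrefl[OF assms(1)] strict_order_on_irrefl[OF l]
    and tr = strict_order_on_trans[OF assms(1)] and tl = strict_order_on_trans[OF l]
  note ex = complementary_order_onD[OF assms(2)]
  have tot: "r x y \<or> r y x \<or> l x y \<or> l y x" if "x \<in> P" "y \<in> P" "x \<noteq> y" for x y
    using ex[OF that] by blast
  have disj: "\<not> l x y" "\<not> l y x" if "x \<in> P" "y \<in> P" "r x y" for x y
    using ex[of x y] irr[of x] that by auto
  have trans: "r x z \<or> l x z"
    if P: "x \<in> P" "y \<in> P" "z \<in> P" and xy: "r x y \<or> l x y" and yz: "r y z \<or> l y z" for x y z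
  proof -
    consider "r x y" "r y z" | "l x y" "l y z" | "r x y" "l y z" | "l x y" "r y z"
      using xy yz by blast
    then show ?thesis
    proof cases
      case 1
      then show ?thesis using tr[OF P] by blast
    next
      case 2
      then show ?thesis using tl[OF P] by blast
    next
      case 3
      \<comment> \<open>Equality, or an edge from \<open>z\<close> back to \<open>x\<close> composed
        with the given edge of its kind, would make some pair comparable in both orders. Totality
        then leaves only an edge from \<open>x\<close> to \<open>z\<close>.\<close>
      have "x \<noteq> z" using 3 disj[of x y] P by blast
      moreover have "\<not> r z x" using 3 tr[of z x y] disj[of z y] P by blast
      moreover have "\<not> l z x" using 3 tl[of y z x] disj[of x y] P by blast
      ultimately show ?thesis using tot[of x z] P by blast
    next
      case 4
      have "x \<noteq> z" using 4 disj[of y z] P by blast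
      moreover have "\<not> r z x" using 4 tr[of y z x] disj[of y x] P by blast
      moreover have "\<not> l z x" using 4 tl[of z x y] disj[of y z] P by blast
      ultimately show ?thesis using tot[of x z] P by blast
    qed
  qed
  have "transp_on P (sup r l)"
    unfolding sup_fun_def sup_bool_def by (rule transp_onI) (erule (4) trans)
  then show ?thesis
    using irr by (simp add: strict_order_on_def irreflp_on_def)
qed

lemma complementary_order_on_disjoint:
  assumes "strict_order_on P r" "complementary_order_on P r l" "p \<in> P" "q \<in> P"
  shows "\<not> (r p q \<and> l p q)"
proof (cases "p = q")
  case True
  then show ?thesis using assms(1,4) by (simp add: strict_order_on_def irreflp_on_def)
next
  case False
  then have "(r p q \<or> r q p) \<noteq> (l p q \<or> l q p)"
    by (rule complementary_order_onD[OF assms(2-4)])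
  then show ?thesis by blast
qed

text \<open>The sum is the imbalance in \<open>sup r l\<close>, a strict order containing
  \<open>r\<close>, so strict monotonicity applies.\<close>

lemma complementary_imbalance_sum_less:
  assumes "finite P" "strict_order_on P r" "complementary_order_on P r l"
    and "p \<in> P" "q \<in> P" "r p q"
  shows "imbalance P r p + imbalance P l p < imbalance P r q + imbalance P l q"
proof -
  have "imbalance P (sup r l) z = imbalance P r z + imbalance P l z" if "z \<in> P" for z
    using assms(1) that complementary_order_on_disjoint[OF assms(2,3)]
    by (intro imbalance_disjoint_sup)
  moreover have "imbalance P (sup r l) p < imbalance P (sup r l) q"
    using assms(6)
    by (intro imbalance_strict_mono assms complementary_order_on_sup) simp
  ultimately show ?thesis
    using assms(4,5) by simp
qed

text \<open>The sum estimate is used for \<open>l\<close> and for its converse, whose imbalance has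
  the opposite sign; the two results are the two halves of the absolute value bound.\<close>

lemma complementary_imbalance_abs_less:
  assumes "finite P" "strict_order_on P r" "complementary_order_on P r l"
    and "p \<in> P" "q \<in> P" "r p q"
  shows "\<bar>imbalance P l q - imbalance P l p\<bar> < imbalance P r q - imbalance P r p"
  using complementary_imbalance_sum_less[OF assms]
    complementary_imbalance_sum_less[OF assms(1,2) complementary_order_on_conversep[OF assms(3)] assms(4-6)]
  by (simp add: imbalance_conversep)

section \<open>The slanted orders in coordinates\<close>

text \<open>Here \<open>a\<close> is the component along the axis and \<open>b\<close> the one
  across it. Since \<open>arccos\<close> is decreasing with value \<open>pi / 4\<close> at
  \<open>1 / sqrt 2\<close>, the angle bound becomes a comparison of \<open>b\<^sup>2\<close> with
  \<open>a\<^sup>2\<close>.\<close>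

lemma arccos_pi4_iff:
  fixes a b :: real
  assumes "a \<noteq> 0 \<or> b \<noteq> 0"
  shows arccos_le_pi4_iff: "arccos (a / sqrt (a\<^sup>2 + b\<^sup>2)) \<le> pi / 4 \<longleftrightarrow> \<bar>b\<bar> \<le> a" (is ?le)
    and arccos_less_pi4_iff: "arccos (a / sqrt (a\<^sup>2 + b\<^sup>2)) < pi / 4 \<longleftrightarrow> \<bar>b\<bar> < a" (is ?less)
proof -
  let ?n = "sqrt (a\<^sup>2 + b\<^sup>2)"
  have n: "?n > 0" using assms by (simp add: sum_power2_gt_zero_iff)
  have "\<bar>a\<bar> \<le> ?n" by (rule real_le_rsqrt) simp
  then have bound: "\<bar>a / ?n\<bar> \<le> 1" using n by simp
  have bound2: "\<bar>1 / sqrt 2\<bar> \<le> (1::real)" by simp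
  have le: "1 / sqrt 2 \<le> a / ?n \<longleftrightarrow> \<bar>b\<bar> \<le> a" and less: "1 / sqrt 2 < a / ?n \<longleftrightarrow> \<bar>b\<bar> < a"
  proof -
    have sq: "sqrt 2 * a = sqrt (2 * a\<^sup>2)" if "a \<ge> 0"
      using that by (simp add: real_sqrt_mult)
    have ab: "\<bar>b\<bar> \<le> a \<longleftrightarrow> b\<^sup>2 \<le> a\<^sup>2" "\<bar>b\<bar> < a \<longleftrightarrow> b\<^sup>2 < a\<^sup>2" if "a \<ge> 0"
      using that abs_le_square_iff[of b a] abs_le_square_iff[of a b] by auto
    have main: "(1 / sqrt 2 \<le> a / ?n \<longleftrightarrow> ?n \<le> sqrt 2 * a) \<and> (1 / sqrt 2 < a / ?n \<longleftrightarrow> ?n < sqrt 2 * a)"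
      using n by (simp add: pos_le_divide_eq pos_less_divide_eq pos_divide_le_eq pos_divide_less_eq mult.commute)
    \<comment> \<open>For negative \<open>a\<close> both sides of each equivalence fail, so squaring
      is only applied to nonnegative \<open>a\<close>.\<close>
    have "a \<ge> 0 \<or> (\<not> \<bar>b\<bar> \<le> a \<and> \<not> ?n \<le> sqrt 2 * a)"
      using n by (smt (verit) mult_nonneg_nonpos real_sqrt_ge_zero)
    then show "1 / sqrt 2 \<le> a / ?n \<longleftrightarrow> \<bar>b\<bar> \<le> a" "1 / sqrt 2 < a / ?n \<longleftrightarrow> \<bar>b\<bar> < a"
      using main sq ab by auto
  qed
  show ?le using arccos_le_mono[OF bound bound2] le arccos_one_over_sqrt_2 by simp
  show ?less using arccos_less_mono[OF bound bound2] less arccos_one_over_sqrt_2 by simp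
qed

lemma slanted_iff: "slanted p q \<longleftrightarrow> p \<noteq> q \<and> \<bar>fst q - fst p\<bar> \<le> snd q - snd p"
  using arccos_le_pi4_iff[of "snd q - snd p" "fst q - fst p"]
  by (auto simp: slanted_def vec_angle_def inner_prod_def norm_prod_def prod_eq_iff add.commute)

lemma slanted_lr_iff: "slanted_lr p q \<longleftrightarrow> \<bar>snd q - snd p\<bar> < fst q - fst p"
proof (cases "p = q")
  case False
  then have "fst q - fst p \<noteq> 0 \<or> snd q - snd p \<noteq> 0" by (auto simp: prod_eq_iff)
  from arccos_less_pi4_iff[OF this] show ?thesis
    using False by (simp add: slanted_lr_def vec_angle_def inner_prod_def norm_prod_def)
qed (simp add: slanted_lr_def)

section \<open>Covering segments and planarity\<close>

text \<open>The vector \<open>z - p\<close> is a positive multiple of both \<open>q - p\<close> and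
  \<open>q' - p\<close>, so \<open>q\<close> and \<open>q'\<close> lie on one ray from
  \<open>p\<close>; the one with the larger coefficient is the nearer.\<close>

lemma closed_segments_common_start:
  fixes p :: "'a::real_vector"
  assumes "z \<in> closed_segment p q" "z \<in> closed_segment p q'" "z \<noteq> p"
  shows "q \<in> closed_segment p q' \<or> q' \<in> closed_segment p q"
proof -
  obtain s where s: "0 \<le> s" "s \<le> 1" "z - p = s *\<^sub>R (q - p)"
    using assms(1) by (auto simp: in_segment algebra_simps)
  obtain t where t: "0 \<le> t" "t \<le> 1" "z - p = t *\<^sub>R (q' - p)"
    using assms(2) by (auto simp: in_segment algebra_simps)
  have pos: "s > 0" "t > 0"
    using s t assms(3) by (auto simp: order_less_le)
  have *: "y \<in> closed_segment p x" if "0 < a" "a \<le> b" "a *\<^sub>R (x - p) = b *\<^sub>R (y - p)" for a b x y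
  proof -
    have "y - p = (1 / b) *\<^sub>R (b *\<^sub>R (y - p))"
      using that(1,2) by simp
    also have "\<dots> = (a / b) *\<^sub>R (x - p)"
      by (simp flip: that(3))
    finally have "y - p = (a / b) *\<^sub>R (x - p)" .
    then have "y = (1 - a / b) *\<^sub>R p + (a / b) *\<^sub>R x"
      by (simp add: algebra_simps)
    then show ?thesis
      using that by (auto simp: in_segment intro!: exI[of _ "a / b"])
  qed
  show ?thesis
    using *[of s t q q'] *[of t s q' q] pos s(3) t(3) by (metis linear)
qed

text \<open>The displacements from \<open>p\<close> to \<open>z\<close> and from \<open>z\<close> to
  \<open>q\<close> are nonnegative multiples of the one from \<open>p\<close> to \<open>q\<close>,
  and the closed cone is stable under such scaling.\<close>

lemma closed_segment_slanted:
  assumes "slanted p q" "z \<in> closed_segment p q"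
  shows "slanted\<^sup>=\<^sup>= p z" "slanted\<^sup>=\<^sup>= z q"
proof -
  obtain t where t: "0 \<le> t" "t \<le> 1" "z = (1 - t) *\<^sub>R p + t *\<^sub>R q"
    using assms(2) by (auto simp: in_segment)
  have "fst z - fst p = t * (fst q - fst p)" "snd z - snd p = t * (snd q - snd p)"
    "fst q - fst z = (1 - t) * (fst q - fst p)" "snd q - snd z = (1 - t) * (snd q - snd p)"
    by (auto simp: t(3) algebra_simps)
  then show "slanted\<^sup>=\<^sup>= p z" "slanted\<^sup>=\<^sup>= z q"
    using assms(1) t(1,2) by (auto simp: slanted_iff abs_mult intro!: mult_left_mono)
qed

lemma slanted_trans: "slanted p q \<Longrightarrow> slanted q z \<Longrightarrow> slanted p z"
  by (auto simp: slanted_iff prod_eq_iff)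

lemma slanted_covers_segment:
  assumes "covers_on M slanted p q"
  shows "closed_segment p q \<inter> M = {p, q}"
proof -
  have pq: "p \<in> M" "q \<in> M" "slanted p q" and none: "\<And>z. z \<in> M \<Longrightarrow> \<not> (slanted p z \<and> slanted z q)"
    using assms by (auto simp: covers_on_def)
  have "z = p \<or> z = q" if "z \<in> closed_segment p q" "z \<in> M" for z
    using closed_segment_slanted[OF pq(3) that(1)] none[OF that(2)] by auto
  then show ?thesis
    using pq by auto
qed

lemma slanted_lattice_planar:
  assumes "finite M" and lat: "lattice_order_on M slanted"
  shows "planar_lattice_diagram M slanted"
proof -
  have cross: "z \<in> {p, q} \<inter> {p', q'}"
    if c: "covers_on M slanted p q" and c': "covers_on M slanted p' q'"
      and ne: "closed_segment p q \<noteq> closed_segment p' q'"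
      and z: "z \<in> closed_segment p q" and z': "z \<in> closed_segment p' q'" for p q p' q' z
  proof (cases "z \<in> M")
    case True
    then show ?thesis
      using slanted_covers_segment[OF c] slanted_covers_segment[OF c'] z z' by blast
  next
    case False
    have M: "p \<in> M" "q \<in> M" "p' \<in> M" "q' \<in> M"
      using c c' by (auto simp: covers_on_def)
    have lt: "slanted p z" "slanted z q" "slanted p' z" "slanted z q'"
      using closed_segment_slanted[of p q z] closed_segment_slanted[of p' q' z] c c' z z' M False
      by (auto simp: covers_on_def)
    \<comment> \<open>The point \<open>z\<close> is not in \<open>M\<close>, but
      \<open>slanted\<close> is transitive on the whole plane, so both lower ends are below both
      upper ends.\<close>
    then have lt': "slanted p q'" "slanted p' q" "slanted p q" "slanted p' q'"
      by (blast intro: slanted_trans)+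
    have "\<exists>m\<in>M. slanted\<^sup>=\<^sup>= p m \<and> slanted\<^sup>=\<^sup>= p' m \<and>
        (\<forall>z\<in>M. slanted\<^sup>=\<^sup>= p z \<and> slanted\<^sup>=\<^sup>= p' z \<longrightarrow> slanted\<^sup>=\<^sup>= m z)"
      using lat M(1,3) by (simp only: lattice_order_on_iff)
    then obtain m where "m \<in> M" "slanted\<^sup>=\<^sup>= p m" "slanted\<^sup>=\<^sup>= p' m"
      and "\<And>z. z \<in> M \<Longrightarrow> slanted\<^sup>=\<^sup>= p z \<Longrightarrow> slanted\<^sup>=\<^sup>= p' z \<Longrightarrow> slanted\<^sup>=\<^sup>= m z"
      by blast
    then have m: "m \<in> M" "slanted\<^sup>=\<^sup>= p m" "slanted\<^sup>=\<^sup>= p' m" "slanted\<^sup>=\<^sup>= m q" "slanted\<^sup>=\<^sup>= m q'"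
      using M lt' by simp_all
    \<comment> \<open>The join \<open>m\<close> lies weakly between the ends of both coverings,
      which leaves it no interior position.\<close>
    have "(m = p \<or> m = q) \<and> (m = p' \<or> m = q')"
      using c c' m by (auto simp: covers_on_def)
    moreover have "p \<noteq> q'" "p' \<noteq> q"
      using lt' by (auto simp: slanted_def)
    ultimately consider "p = p'" | "q = q'" by auto
    then have "q \<in> closed_segment p' q' \<and> p \<in> closed_segment p' q' \<or>
        q' \<in> closed_segment p q \<and> p' \<in> closed_segment p q"
    proof cases
      case 1
      then show ?thesis
        using closed_segments_common_start[of z p q q'] z z' M False by auto
    next
      \<comment> \<open>The segments share their upper end, so the ray argument is run downwards
        from \<open>q\<close>.\<close>
      case 2
      then show ?thesis
        using closed_segments_common_start[of z q p p'] z z' M False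
        by (auto simp: closed_segment_commute)
    qed
    \<comment> \<open>Both ends of one segment are points of \<open>M\<close> on the other, hence
      ends of that one, so the segments coincide, against \<open>ne\<close>.\<close>
    then have "p \<in> {p', q'} \<and> q \<in> {p', q'} \<or> p' \<in> {p, q} \<and> q' \<in> {p, q}"
      unfolding slanted_covers_segment[OF c, symmetric] slanted_covers_segment[OF c', symmetric]
      using M by blast
    moreover have "p \<noteq> q" "p' \<noteq> q'"
      using lt' by (simp_all add: slanted_def)
    ultimately have "p = p' \<and> q = q' \<or> p = q' \<and> q = p'" by blast
    then show ?thesis
      using ne closed_segment_commute by blast
  qed
  \<comment> \<open>A zero vertical displacement would force a zero horizontal one and thus
    \<open>p = q\<close>.\<close>
  have up: "snd p < snd q" if "covers_on M slanted p q" for p q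
    using that by (auto simp: covers_on_def slanted_iff prod_eq_iff)
  have "diagram M slanted"
    unfolding diagram_def using assms
    by (intro conjI allI impI up slanted_covers_segment) (simp_all add: lattice_order_on_def)
  then have "planar_diagram M slanted"
    unfolding planar_diagram_def
    by (intro conjI allI impI subsetI) (assumption, elim conjE IntE, rule cross)
  then show ?thesis
    using lat by (simp add: planar_lattice_diagram_def)
qed

section \<open>The canonical map as an isomorphism of oriented lattices\<close>

theorem theorem13:
  fixes L :: "'a set" and less lam :: "'a \<Rightarrow> 'a \<Rightarrow> bool"
  assumes "finite L" and "lattice_order_on L less" and "complementary_order_on L less lam"
  shows "planar_canonical_form (canon L less lam ` L) slanted \<and>
    oriented_planar_lattice_iso L less lam (canon L less lam ` L) slanted slanted_lr
      (canon L less lam)"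
proof -
  let ?c = "canon L less lam"
  let ?M = "?c ` L"
  have so: "strict_order_on L less" "strict_order_on L lam"
    using assms(2,3) by (simp_all add: lattice_order_on_def complementary_order_on_def)
  have up: "\<bar>fst (?c q) - fst (?c p)\<bar> < snd (?c q) - snd (?c p)"
    if "p \<in> L" "q \<in> L" "less p q" for p q
    using complementary_imbalance_abs_less[OF assms(1) so(1) assms(3) that]
    by (simp add: canon_def flip: of_int_diff of_int_abs)
  have right: "\<bar>snd (?c q) - snd (?c p)\<bar> < fst (?c q) - fst (?c p)"
    if "p \<in> L" "q \<in> L" "lam p q" for p q
    using complementary_imbalance_abs_less[OF assms(1) so(2)
        complementary_order_on_commute[OF so(1) assms(3)] that]
    by (simp add: canon_def flip: of_int_diff of_int_abs)
  have cases: "less p q \<or> less q p \<or> lam p q \<or> lam q p" if "p \<in> L" "q \<in> L" "p \<noteq> q" for p q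
    using complementary_order_onD[OF assms(3) that] by blast
  have irr: "\<not> less p p \<and> \<not> lam p p" if "p \<in> L" for p
    using strict_order_on_irrefl[OF so(1) that] strict_order_on_irrefl[OF so(2) that] by simp
  have inj: "inj_on ?c L"
  proof (rule inj_onI, rule ccontr)
    fix p q assume "p \<in> L" "q \<in> L" "?c p = ?c q" "p \<noteq> q"
    then show False using cases[of p q] up[of p q] up[of q p] right[of p q] right[of q p] by auto
  qed
  \<comment> \<open>The four ways of comparing distinct elements send the displacement into four
    disjoint open cones, so the implications \<open>up\<close> and \<open>right\<close> can be
    reversed.\<close>
  have "less p q \<longleftrightarrow> slanted (?c p) (?c q)" if "p \<in> L" "q \<in> L" for p q
    using that cases[of p q] up[of p q] up[of q p] right[of p q] right[of q p] irr[of p]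
    by (cases "p = q") (auto simp: slanted_iff prod_eq_iff)
  then have iso: "order_iso_on L less ?M slanted ?c"
    using inj by (simp add: order_iso_on_def bij_betw_def)
  have "lam p q \<longleftrightarrow> slanted_lr (?c p) (?c q)" if "p \<in> L" "q \<in> L" for p q
    using that cases[of p q] up[of p q] up[of q p] right[of p q] right[of q p] irr[of p]
    by (cases "p = q") (auto simp: slanted_lr_iff)
  then have iso_lr: "order_iso_on L lam ?M slanted_lr ?c"
    using inj by (simp add: order_iso_on_def bij_betw_def)
  have lat: "lattice_order_on ?M slanted"
    using order_iso_on_lattice_order[OF iso assms(2)] .
  have pld: "planar_lattice_diagram ?M slanted"
    using assms(1) lat by (intro slanted_lattice_planar) auto
  have id: "order_iso_on ?M slanted ?M slanted id"
    by (simp add: order_iso_on_def)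
  have "planar_canonical_form ?M slanted"
    using pld order_iso_on_imbalance[OF iso] order_iso_on_imbalance[OF iso_lr]
    \<comment> \<open>\<open>canon\<close> stays folded until the imbalances in the image are
      rewritten to those in \<open>L\<close>; unfolding it then leaves the same pair on both
      sides.\<close>
    by (simp add: planar_canonical_form_def) (simp add: canon_def)
  \<comment> \<open>Planarity of \<open>L\<close> is a conclusion: its canonical image is the planar
    diagram that witnesses it.\<close>
  moreover have "oriented_planar_lattice L less lam"
    unfolding oriented_planar_lattice_def planar_lattice_def
    by (intro conjI assms) (rule exI, rule exI, rule exI, rule conjI[OF pld iso])
  moreover have "oriented_planar_lattice ?M slanted slanted_lr"
    unfolding oriented_planar_lattice_def planar_lattice_def
    by (intro conjI finite_imageI assms(1) lat order_iso_on_complementary_order[OF iso iso_lr assms(3)])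
      (rule exI, rule exI, rule exI, rule conjI[OF pld id])
  ultimately show ?thesis
    using iso iso_lr by (simp add: oriented_planar_lattice_iso_def)
qed

end
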